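(* Let $(H;\langle\cdot,\cdot\rangle)$ be an inner product space over the real or complex number field $\mathbb{K}$, let $n\ge 2$ be an integer and let $x_i\in H$ for $i\in\{1,\dots,n\}$. Then $$\Big(\sum_{i=1}^n\|x_i\|\Big)^2\le\Big\|\sum_{i=1}^n x_i\Big\|^2+\frac{n^2(n^2-1)}{12}\max_{1\le k\le n-1}\|\Delta x_k\|^2.$$ The constant $\frac1{12}$ is best possible: if $H\neq\{0\}$ and $D>0$ is a constant such that $$\Big(\sum_{i=1}^n\|x_i\|\Big)^2\le\Big\|\sum_{i=1}^n x_i\Big\|^2+D\,n^2(n^2-1)\max_{1\le k\le n-1}\|\Delta x_k\|^2$$ for all $n\ge2$ and all $x_1,\dots,x_n\in H$, then $D\ge\frac1{12}$.
   Context: $\|\cdot\|$ is the norm induced by the inner product, and $\Delta x_k:=x_{k+1}-x_k$ for $1\le k\le n-1$ denotes the forward difference. *)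

theory Defs
  imports "HOL-Analysis.Inner_Product"
begin

text \<open>
  The scalar field is the field of real or of complex numbers: a field together with
  an isomorphism onto \<^term>\<open>\<real> :: complex set\<close> or \<^term>\<open>UNIV :: complex set\<close>.
\<close>

class real_or_complex = field +
  fixes to_complex :: "'a \<Rightarrow> complex"
  assumes to_complex_one: "to_complex 1 = 1"
    and to_complex_add: "to_complex (a + b) = to_complex a + to_complex b"
    and to_complex_mult: "to_complex (a * b) = to_complex a * to_complex b"
    and inj_to_complex: "inj to_complex"
    and range_to_complex: "range to_complex = \<real> \<or> range to_complex = UNIV"

instantiation real :: real_or_complex
begin

definition to_complex_real :: "real \<Rightarrow> complex"
  where "to_complex_real = complex_of_real"

instance
  by standard (auto simp: to_complex_real_def inj_def Reals_def)

end

instantiation complex :: real_or_complex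
begin

definition to_complex_complex :: "complex \<Rightarrow> complex"
  where "to_complex_complex z = z"

instance
  by standard (auto simp: to_complex_complex_def inj_def)

end

text \<open>
  The inner product is linear in its first argument.  In the real case \<^term>\<open>cnj\<close>
  acts trivially, so that conjugate symmetry is symmetry.
\<close>

locale inner_product_space = vector_space scale
  for scale :: "'k::real_or_complex \<Rightarrow> 'v::ab_group_add \<Rightarrow> 'v" +
  fixes ip :: "'v \<Rightarrow> 'v \<Rightarrow> 'k"
  assumes ip_add_left: "ip (x + y) z = ip x z + ip y z"
    and ip_scale_left: "ip (scale a x) y = a * ip x y"
    and ip_commute: "to_complex (ip y x) = cnj (to_complex (ip x y))"
    and ip_self_real: "to_complex (ip x x) \<in> \<real>"
    and ip_self_pos: "x \<noteq> 0 \<Longrightarrow> 0 < Re (to_complex (ip x x))"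

definition ip_norm :: "('v \<Rightarrow> 'v \<Rightarrow> 'k::real_or_complex) \<Rightarrow> 'v \<Rightarrow> real"
  where "ip_norm ip x = sqrt (Re (to_complex (ip x x)))"

definition fdiff :: "(nat \<Rightarrow> 'v::ab_group_add) \<Rightarrow> nat \<Rightarrow> 'v"
  where "fdiff x k = x (k + 1) - x k"

text \<open>
  Every \<^class>\<open>real_inner\<close> space is covered, with its own norm, and so is the complex
  field as an inner product space over itself.
\<close>

lemma inner_product_space_real_inner:
  "inner_product_space scaleR (inner :: 'a::real_inner \<Rightarrow> 'a \<Rightarrow> real)"
  by unfold_locales
    (auto simp: to_complex_real_def inner_add_left scaleR_add_right scaleR_add_left
      intro: inner_commute)

lemma ip_norm_inner: "ip_norm inner x = norm (x :: 'a::real_inner)"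
  by (simp add: ip_norm_def to_complex_real_def norm_eq_sqrt_inner)

lemma inner_product_space_complex:
  "inner_product_space (*) (\<lambda>z w :: complex. z * cnj w)"
  by unfold_locales
    (auto simp: to_complex_complex_def algebra_simps complex_is_Real_iff complex_eq_iff
      power2_eq_square[symmetric] sum_power2_gt_zero_iff)

lemma ip_norm_complex: "ip_norm (\<lambda>z w :: complex. z * cnj w) z = norm z"
  by (simp add: ip_norm_def to_complex_complex_def cmod_def power2_eq_square)

end

theory Submission
  imports Defs
begin

text \<open>
  Write \<open>r x y\<close> for the real part of \<open>\<langle>x, y\<rangle>\<close>. Expanding both squares gives
  \<open>(\<Sum>\<^sub>i \<parallel>x\<^sub>i\<parallel>)\<^sup>2 - \<parallel>\<Sum>\<^sub>i x\<^sub>i\<parallel>\<^sup>2 = \<Sum>\<^sub>i\<^sub>,\<^sub>j (\<parallel>x\<^sub>i\<parallel> \<parallel>x\<^sub>j\<parallel> - r x\<^sub>i x\<^sub>j)\<close>,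
  and each summand is at most \<open>\<parallel>x\<^sub>i - x\<^sub>j\<parallel>\<^sup>2 / 2\<close> (\<open>sqrt_mult_sqrt_minus_le\<close>), the
  defect being \<open>(\<parallel>x\<^sub>i\<parallel> - \<parallel>x\<^sub>j\<parallel>)\<^sup>2 / 2\<close>. The difference \<open>x\<^sub>i - x\<^sub>j\<close> telescopes into
  \<open>\<bar>i - j\<bar>\<close> forward differences, so \<open>\<parallel>x\<^sub>i - x\<^sub>j\<parallel>\<^sup>2 \<le> (i - j)\<^sup>2 M\<close>, where \<open>M\<close> is the
  maximum on the right-hand side (\<open>telescope_self_le\<close>). The constant then comes from the identity
  \<open>\<Sum>\<^sub>i\<^sub>,\<^sub>j (i - j)\<^sup>2 = n\<^sup>2 (n\<^sup>2 - 1) / 6\<close> (\<open>sum_sum_diff_power2\<close>).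

  The constant is already attained for \<open>n = 2\<close>, by \<open>x\<^sub>1 = v\<close> and \<open>x\<^sub>2 = -v\<close> with
  \<open>v \<noteq> 0\<close>: the left-hand side is \<open>4 \<parallel>v\<parallel>\<^sup>2\<close>, the sum of the vectors vanishes, and the
  only forward difference is \<open>-2v\<close>, so that \<open>4 \<parallel>v\<parallel>\<^sup>2 \<le> 48 D \<parallel>v\<parallel>\<^sup>2\<close>.
\<close>

text \<open>
  The real part of an inner product is a form of this kind over either scalar field, which
  lets the real and the complex case be treated at once.
\<close>

locale positive_biadditive_form =
  fixes r :: "'v::ab_group_add \<Rightarrow> 'v \<Rightarrow> real"
  assumes add_left: "r (x + y) z = r x z + r y z"
    and commute: "r x y = r y x"
    and nonneg: "0 \<le> r x x"
begin

lemma add_right: "r z (x + y) = r z x + r z y"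
  by (simp only: commute[of z] add_left)

lemma zero_left [simp]: "r 0 z = 0"
  using add_left[of 0 0 z] by simp

lemma minus_left: "r (- x) z = - r x z"
  using add_left[of x "- x" z] by simp

lemma minus_right: "r z (- x) = - r z x"
  by (simp only: commute[of z] minus_left)

lemma sum_left: "r (sum f A) z = (\<Sum>i\<in>A. r (f i) z)"
  by (induction A rule: infinite_finite_induct) (auto simp: add_left)

lemma sum_right: "r z (sum f A) = (\<Sum>i\<in>A. r z (f i))"
  by (simp only: commute[of z] sum_left)

lemma sum_sum: "r (sum f A) (sum g B) = (\<Sum>i\<in>A. \<Sum>j\<in>B. r (f i) (g j))"
  by (simp only: sum_left) (simp only: sum_right)

lemma diff_self: "r (x - y) (x - y) = r x x + r y y - 2 * r x y"
proof -
  have "r (x - y) (x - y) = r x x + r x (- y) + (r (- y) x + r (- y) (- y))"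
    by (simp only: diff_conv_add_uminus add_left add_right)
  then show ?thesis
    by (simp add: minus_left minus_right commute[of y x])
qed

text \<open>
  The squared form of the triangle inequality for vectors of bounded length. Each mixed term
  in the expansion of the square is at most the arithmetic mean of two squares, because
  \<open>r (x - y) (x - y)\<close> is nonnegative.
\<close>

lemma sum_self_le:
  assumes "\<And>i. i \<in> A \<Longrightarrow> r (f i) (f i) \<le> M"
  shows "r (sum f A) (sum f A) \<le> (real (card A))\<^sup>2 * M"
proof -
  have "r (f i) (f j) \<le> M" if "i \<in> A" "j \<in> A" for i j
    using nonneg[of "f i - f j"] assms[OF that(1)] assms[OF that(2)]
    by (simp add: diff_self)
  then have "r (sum f A) (sum f A) \<le> (\<Sum>i\<in>A. \<Sum>j\<in>A. M)"
    unfolding sum_sum by (intro sum_mono)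
  then show ?thesis
    by (simp add: power2_eq_square mult.assoc)
qed

lemma telescope_self_le:
  fixes x :: "nat \<Rightarrow> 'v"
  assumes "\<And>k. k \<in> {1..n-1} \<Longrightarrow> r (fdiff x k) (fdiff x k) \<le> M"
    and "i \<in> {1..n}" "j \<in> {1..n}"
  shows "r (x i - x j) (x i - x j) \<le> (real i - real j)\<^sup>2 * M"
proof -
  have ordered: "r (x b - x a) (x b - x a) \<le> (real b - real a)\<^sup>2 * M"
    if "1 \<le> a" "a \<le> b" "b \<le> n" for a b
  proof -
    have "x b - x a = (\<Sum>k=a..<b. fdiff x k)"
      using sum_Suc_diff'[of a b x] that by (simp add: fdiff_def)
    moreover have "r (fdiff x k) (fdiff x k) \<le> M" if "k \<in> {a..<b}" for k
      using that \<open>1 \<le> a\<close> \<open>b \<le> n\<close> by (intro assms(1)) auto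
    ultimately show ?thesis
      using sum_self_le[of "{a..<b}" "fdiff x" M] that by (simp add: of_nat_diff)
  qed
  have flip: "r (x i - x j) (x i - x j) = r (x j - x i) (x j - x i)"
    by (simp add: diff_self commute[of "x i" "x j"])
  show ?thesis
    using ordered[of j i] ordered[of i j] assms(2,3) flip
    by (cases "j \<le> i") (auto simp: power2_commute)
qed

text \<open>
  The defect in this inequality is half of the square of
  \<open>sqrt (r x x) - sqrt (r y y)\<close>.
\<close>

lemma sqrt_mult_sqrt_minus_le:
  "sqrt (r x x) * sqrt (r y y) - r x y \<le> r (x - y) (x - y) / 2"
proof -
  have "0 \<le> (sqrt (r x x) - sqrt (r y y))\<^sup>2"
    by simp
  also have "\<dots> = r x x + r y y - 2 * (sqrt (r x x) * sqrt (r y y))"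
    by (simp add: power2_diff nonneg)
  finally show ?thesis
    unfolding diff_self by (simp add: field_simps)
qed

end

lemma sum_of_nat_power2: "(\<Sum>i=1..n. (real i)\<^sup>2) = real n * (real n + 1) * (2 * real n + 1) / 6"
  by (induction n) (auto simp: field_simps power2_eq_square)

lemma sum_of_nat: "(\<Sum>i=1..n. real i) = real n * (real n + 1) / 2"
  by (induction n) (auto simp: field_simps)

lemma sum_sum_diff_power2:
  "(\<Sum>i=1..n. \<Sum>j=1..n. (real i - real j)\<^sup>2) = (real n)\<^sup>2 * ((real n)\<^sup>2 - 1) / 6"
proof -
  let ?S = "\<Sum>i=1..n. real i" and ?Q = "\<Sum>i=1..n. (real i)\<^sup>2"
  have "(\<Sum>i=1..n. \<Sum>j=1..n. (real i - real j)\<^sup>2) = 2 * real n * ?Q - 2 * ?S\<^sup>2"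
    by (simp add: power2_diff sum.distrib sum_subtractf mult.assoc
        flip: sum_distrib_left sum_distrib_right power2_eq_square)
  then show ?thesis
    unfolding sum_of_nat_power2 sum_of_nat by (simp add: field_simps power2_eq_square)
qed

lemma (in positive_biadditive_form) sum_sqrt_power2_le:
  fixes x :: "nat \<Rightarrow> 'v"
  assumes "\<And>k. k \<in> {1..n-1} \<Longrightarrow> r (fdiff x k) (fdiff x k) \<le> M"
  shows "(\<Sum>i=1..n. sqrt (r (x i) (x i)))\<^sup>2
    \<le> r (\<Sum>i=1..n. x i) (\<Sum>i=1..n. x i) + (real n)\<^sup>2 * ((real n)\<^sup>2 - 1) / 12 * M"
proof -
  let ?s = "\<lambda>i. sqrt (r (x i) (x i))"
  have "(\<Sum>i=1..n. ?s i)\<^sup>2 - r (\<Sum>i=1..n. x i) (\<Sum>i=1..n. x i)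
      = (\<Sum>i=1..n. \<Sum>j=1..n. ?s i * ?s j - r (x i) (x j))"
    by (simp add: sum_sum power2_eq_square sum_product sum_subtractf)
  also have "\<dots> \<le> (\<Sum>i=1..n. \<Sum>j=1..n. (real i - real j)\<^sup>2 * (M / 2))"
  proof (intro sum_mono)
    fix i j assume "i \<in> {1..n}" "j \<in> {1..n}"
    from telescope_self_le[OF assms this] sqrt_mult_sqrt_minus_le[of "x i" "x j"]
    show "?s i * ?s j - r (x i) (x j) \<le> (real i - real j)\<^sup>2 * (M / 2)"
      by simp
  qed
  also have "\<dots> = (real n)\<^sup>2 * ((real n)\<^sup>2 - 1) / 12 * M"
    by (simp only: sum_distrib_right[symmetric] sum_sum_diff_power2)
  finally show ?thesis by simp
qed

lemma (in inner_product_space) positive_biadditive_form_Re_ip: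
  "positive_biadditive_form (\<lambda>x y. Re (to_complex (ip x y)))"
proof
  have "to_complex (ip 0 0) = to_complex (ip 0 0) + to_complex (ip 0 0)"
    unfolding to_complex_add[symmetric] ip_add_left[symmetric] by simp
  then have zero: "to_complex (ip 0 0) = 0" by simp
  fix x y z
  show "Re (to_complex (ip (x + y) z)) = Re (to_complex (ip x z)) + Re (to_complex (ip y z))"
    by (simp add: ip_add_left to_complex_add)
  show "Re (to_complex (ip x y)) = Re (to_complex (ip y x))"
    by (simp add: ip_commute[of y x])
  show "0 \<le> Re (to_complex (ip x x))"
    using ip_self_pos[of x] zero by (cases "x = 0") auto
qed

theorem proposition2:
  fixes scale :: "'k::real_or_complex \<Rightarrow> 'v::ab_group_add \<Rightarrow> 'v"
    and ip :: "'v \<Rightarrow> 'v \<Rightarrow> 'k"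
  assumes "inner_product_space scale ip"
  shows "(\<forall>n::nat. \<forall>x::nat \<Rightarrow> 'v. n \<ge> 2 \<longrightarrow>
            (\<Sum>i=1..n. ip_norm ip (x i))\<^sup>2
              \<le> (ip_norm ip (\<Sum>i=1..n. x i))\<^sup>2
                + (real n)\<^sup>2 * ((real n)\<^sup>2 - 1) / 12
                  * Max ((\<lambda>k. (ip_norm ip (fdiff x k))\<^sup>2) ` {1..n-1}))
       \<and> (\<forall>D::real. (UNIV :: 'v set) \<noteq> {0} \<longrightarrow> D > 0 \<longrightarrow>
            (\<forall>n::nat. \<forall>x::nat \<Rightarrow> 'v. n \<ge> 2 \<longrightarrow>
              (\<Sum>i=1..n. ip_norm ip (x i))\<^sup>2
                \<le> (ip_norm ip (\<Sum>i=1..n. x i))\<^sup>2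
                  + D * (real n)\<^sup>2 * ((real n)\<^sup>2 - 1)
                    * Max ((\<lambda>k. (ip_norm ip (fdiff x k))\<^sup>2) ` {1..n-1})) \<longrightarrow>
            D \<ge> 1 / 12)"
proof -
  interpret inner_product_space scale ip by fact
  define r where "r = (\<lambda>x y. Re (to_complex (ip x y)))"
  interpret positive_biadditive_form r
    unfolding r_def by (rule positive_biadditive_form_Re_ip)
  have norm_eq: "ip_norm ip v = sqrt (r v v)" for v
    by (simp add: ip_norm_def r_def)
  then have norm_power2: "(ip_norm ip v)\<^sup>2 = r v v" for v
    by (simp add: nonneg)
  show ?thesis
  proof (intro conjI allI impI)
    fix n :: nat and x :: "nat \<Rightarrow> 'v"
    show "(\<Sum>i=1..n. ip_norm ip (x i))\<^sup>2
        \<le> (ip_norm ip (\<Sum>i=1..n. x i))\<^sup>2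
          + (real n)\<^sup>2 * ((real n)\<^sup>2 - 1) / 12
            * Max ((\<lambda>k. (ip_norm ip (fdiff x k))\<^sup>2) ` {1..n-1})"
      unfolding norm_power2 unfolding norm_eq
      by (intro sum_sqrt_power2_le Max_ge) auto
  next
    fix D :: real
    assume nontrivial: "(UNIV :: 'v set) \<noteq> {0}"
      and bound: "\<forall>n::nat. \<forall>x::nat \<Rightarrow> 'v. n \<ge> 2 \<longrightarrow>
          (\<Sum>i=1..n. ip_norm ip (x i))\<^sup>2
            \<le> (ip_norm ip (\<Sum>i=1..n. x i))\<^sup>2
              + D * (real n)\<^sup>2 * ((real n)\<^sup>2 - 1)
                * Max ((\<lambda>k. (ip_norm ip (fdiff x k))\<^sup>2) ` {1..n-1})"
    from nontrivial obtain v :: 'v where "v \<noteq> 0" by blast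
    then have pos: "0 < r v v"
      unfolding r_def by (rule ip_self_pos)
    let ?x = "\<lambda>i::nat. if i = 1 then v else - v"
    have two: "{1..2} = {1, 2 :: nat}" by auto
    have minus_self: "r (- v) (- v) = r v v"
      by (simp add: minus_left minus_right)
    have diff: "r (fdiff ?x 1) (fdiff ?x 1) = 4 * r v v"
      using diff_self[of "- v" v] by (simp add: fdiff_def minus_left minus_right)
    have "(\<Sum>i=1..2. ip_norm ip (?x i))\<^sup>2 = 4 * r v v"
      by (simp only: two norm_eq) (simp add: minus_self nonneg power_mult_distrib flip: mult_2)
    moreover have "(\<Sum>i=1..2. ?x i) = 0"
      by (simp only: two) simp
    ultimately have "4 * r v v \<le> 48 * D * r v v"
      using bound[rule_format, of 2 ?x] diff by (simp add: norm_power2)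
    with pos show "D \<ge> 1 / 12" by simp
  qed
qed

end
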